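(* For integers $m \geq 0$ define $a_m := rd_o(2m + 1) - rd_e(2m + 1)$ and $b_m := rd_o(2m) - rd_e(2m)$. Then for every $m \geq 0$, \begin{align*} (m+5)(4m^2+28m+29)a_{m+4} ={}& 4(2m^3+21m^2+58m+43)a_{m+1} \\ &+(4m^3+44m^2+127m+117)a_{m+2} \\ &+2(4m^3+46m^2+142m+107)a_{m+3} \\ &-(m+1)(4m^2+36m+61)a_m, \end{align*} and for every $m \geq 0$, \begin{align*} (m+5)(m^2+2m-2)b_{m+4} ={}& m(m+4)(2m+3)b_{m+1} \\ &+(m+1)(m^2+5m+8)b_{m+2} \\ &+(m+1)(m+4)(2m+3)b_{m+3} \\ &-(m+1)(m^2+4m+1)b_m. \end{align*}
   Context: An integer partition is a weakly decreasing finite sequence $\mu = (\mu_1, \ldots, \mu_m)$ of positive integers (its parts); $\ell(\mu) := m$ is its length. The perimeter of a nonempty partition $\mu$ is $P(\mu) := \mu_1 + \ell(\mu) - 1$; the empty partition is not counted, so $rd_o(0) = rd_e(0) = 0$. $rd_o(n)$ is the number of partitions with perimeter $n$ into distinct parts that have more odd parts than even parts, and $rd_e(n)$ is the number of partitions with perimeter $n$ into distinct parts that have more even parts than odd parts. *)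

theory Defs
  imports Main
begin

definition is_partition :: "nat list \<Rightarrow> bool" where
  "is_partition \<mu> \<longleftrightarrow> sorted_wrt (\<ge>) \<mu> \<and> (\<forall>x\<in>set \<mu>. 0 < x)"

text \<open>Meaningful for nonempty partitions only, whose largest part is \<open>hd \<mu>\<close>.
  The value at the empty list is irrelevant, as \<open>distinct_partitions\<close> excludes it.\<close>

definition perimeter :: "nat list \<Rightarrow> nat" where
  "perimeter \<mu> = hd \<mu> + length \<mu> - 1"

definition distinct_partitions :: "nat \<Rightarrow> nat list set" where
  "distinct_partitions n =
     {\<mu>. is_partition \<mu> \<and> \<mu> \<noteq> [] \<and> distinct \<mu> \<and> perimeter \<mu> = n}"

definition odd_parts :: "nat list \<Rightarrow> nat" where
  "odd_parts \<mu> = length (filter odd \<mu>)"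

definition even_parts :: "nat list \<Rightarrow> nat" where
  "even_parts \<mu> = length (filter even \<mu>)"

definition rd_o :: "nat \<Rightarrow> nat" where
  "rd_o n = card {\<mu> \<in> distinct_partitions n. odd_parts \<mu> > even_parts \<mu>}"

definition rd_e :: "nat \<Rightarrow> nat" where
  "rd_e n = card {\<mu> \<in> distinct_partitions n. even_parts \<mu> > odd_parts \<mu>}"

definition a_seq :: "nat \<Rightarrow> int" where
  "a_seq m = int (rd_o (2 * m + 1)) - int (rd_e (2 * m + 1))"

definition b_seq :: "nat \<Rightarrow> int" where
  "b_seq m = int (rd_o (2 * m)) - int (rd_e (2 * m))"

text \<open>The cardinalities above are those of finite sets.\<close>

lemma finite_distinct_partitions: "finite (distinct_partitions n)"
proof (rule finite_subset)
  show "distinct_partitions n \<subseteq> {\<mu>. set \<mu> \<subseteq> {..n} \<and> length \<mu> \<le> n}"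
  proof
    fix \<mu> assume "\<mu> \<in> distinct_partitions n"
    then show "\<mu> \<in> {\<mu>. set \<mu> \<subseteq> {..n} \<and> length \<mu> \<le> n}"
      by (cases \<mu>)
        (auto simp: distinct_partitions_def is_partition_def perimeter_def intro: trans_le_add1)
  qed
  show "finite {\<mu>. set \<mu> \<subseteq> {..n} \<and> length \<mu> \<le> n}"
    by (rule finite_lists_length_le) simp
qed

lemma rd_0 [simp]: "rd_o 0 = 0" "rd_e 0 = 0"
proof -
  have "distinct_partitions 0 = {}"
    by (auto simp: distinct_partitions_def is_partition_def perimeter_def neq_Nil_conv)
  then show "rd_o 0 = 0" "rd_e 0 = 0"
    by (simp_all add: rd_o_def rd_e_def)
qed

end

theory Submission
  imports Defs
begin

text \<open>
  Fix the largest part \<open>x\<close> of a partition with distinct parts and perimeter \<open>n\<close>; the other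
  \<open>s = n - x\<close> parts form a subset of \<open>{1..<x}\<close>. With \<open>k = (x - 1) div 2\<close>, there are \<open>k\<close> even numbers
  below \<open>x\<close> and \<open>k\<close> (\<open>x\<close> odd) or \<open>k + 1\<close> (\<open>x\<close> even) odd ones. Reflecting \<open>i\<close> into \<open>s - i\<close> in the sum
  over the number \<open>i\<close> of odd parts cancels all but the nearly balanced terms, and
  \<open>\<plusminus>C(k, \<lfloor>s/2\<rfloor>) C(k, \<lceil>s/2\<rceil>)\<close> remains. Summing over \<open>x\<close>, \<open>a\<^sub>m = W\<^sub>m\<^sub>+\<^sub>1 - D\<^sub>m\<close> and \<open>b\<^sub>m = D\<^sub>m - W\<^sub>m\<close> for
  \<open>W\<^sub>n = \<Sum>\<^sub>k C(k, n-1-k)\<^sup>2\<close> and \<open>D\<^sub>n = \<Sum>\<^sub>k C(k, n-1-k) C(k, n-k)\<close>.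

  Pascal's rule gives \<open>2D\<^sub>n = W\<^sub>n\<^sub>+\<^sub>2 - W\<^sub>n\<^sub>+\<^sub>1 - W\<^sub>n\<close>. A second application, together with a quadratic
  relation between three adjacent binomial coefficients, gives a recurrence of order four for \<open>W\<close>.
  The two claims are combinations of three consecutive instances of it.
\<close>

section \<open>Binomial sums and their recurrence\<close>

text \<open>\<open>binom_sum 0\<close> is W and \<open>binom_sum 1\<close> is D. The sum
  \<open>binom_sum 2\<close> occurs only as an intermediate, which \<open>binom_sum_2_eq\<close>
  removes.\<close>

definition binom_sum :: "nat \<Rightarrow> nat \<Rightarrow> int" where
  "binom_sum d n =
     (\<Sum>k<n. int (k choose (n - Suc k)) * int (k choose (n - Suc k + d)))"

text \<open>The quotients q/p and r/q are rational in k and j. This relation is chosen because its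
  coefficients depend only on k + j: on the diagonal k + j = n - 1 they are constant, so it can be
  summed over k.\<close>

lemma binomial_three_term:
  fixes k j :: nat
  defines "p \<equiv> int (k choose j)" and "q \<equiv> int (k choose Suc j)"
    and "r \<equiv> int (k choose Suc (Suc j))"
  shows "(int k + int j + 4) * (p * r) = (int k + int j + 1) * q\<^sup>2 - q * r - 2 * (p * q)"
proof (cases "j < k")
  case True
  have absorb: "(int i + 1) * int (k choose Suc i) = (int k - int i) * int (k choose i)"
    if "i \<le> k" for i
  proof -
    have "Suc i * (k choose Suc i) = (k - i) * (k choose i)"
      using binomial_absorb_comp[of k i] binomial_absorption[of i k]
      by (cases k) simp_all
    then have "int (Suc i * (k choose Suc i)) = int ((k - i) * (k choose i))"
      by simp
    then show ?thesis
      using that by (simp add: of_nat_diff algebra_simps)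
  qed
  have 1: "(int j + 1) * q = (int k - int j) * p"
    and 2: "(int j + 2) * r = (int k - int j - 1) * q"
    using absorb[of j] absorb[of "Suc j"] True by (simp_all add: p_def q_def r_def algebra_simps)
  \<comment> \<open>The factors j + 1 and j + 2 are the denominators of q/p and r/q.\<close>
  have "(int j + 1) * (int j + 2) * ((int k + int j + 4) * (p * r)
      - ((int k + int j + 1) * q\<^sup>2 - q * r - 2 * (p * q))) = 0"
    using 1 2 by algebra
  then show ?thesis by simp
next
  case False
  then show ?thesis by (simp add: p_def q_def r_def binomial_eq_0)
qed

text \<open>Splitting off k = n leaves a sum over the same k < n, in the same lower index n - Suc k,
  as in \<open>binom_sum d n\<close>, so that the two can be compared term by term.\<close>

lemma binom_sum_0_split:
  "binom_sum 0 (n + 1) = (\<Sum>k<n. (int (k choose Suc (n - Suc k)))\<^sup>2) + 1"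
proof -
  have "(\<Sum>k<n. int (k choose (n - k)) * int (k choose (n - k)))
      = (\<Sum>k<n. (int (k choose Suc (n - Suc k)))\<^sup>2)"
    by (rule sum.cong) (auto simp: power2_eq_square Suc_diff_Suc)
  then show ?thesis by (simp add: binom_sum_def)
qed

lemma binom_sum_1_split:
  "binom_sum 1 (n + 1) =
     (\<Sum>k<n. int (k choose Suc (n - Suc k)) * int (k choose Suc (Suc (n - Suc k)))) + int n"
proof -
  have "(\<Sum>k<n. int (k choose (n - k)) * int (k choose (n - k + 1)))
      = (\<Sum>k<n. int (k choose Suc (n - Suc k)) * int (k choose Suc (Suc (n - Suc k))))"
    by (rule sum.cong) (auto simp: Suc_diff_Suc)
  then show ?thesis by (simp add: binom_sum_def)
qed

lemma binom_sum_0_Pascal: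
  "binom_sum 0 (n + 2) = binom_sum 0 (n + 1) + binom_sum 0 n + 2 * binom_sum 1 n"
proof -
  \<comment> \<open>The summand at k = 0 vanishes, so the index can be shifted to make room for
    Pascal's rule.\<close>
  have "binom_sum 0 (n + 2) = (\<Sum>k<Suc n. int (Suc k choose (n - k)) * int (Suc k choose (n - k)))"
    unfolding binom_sum_def
    by (simp add: sum.lessThan_Suc_shift del: sum.lessThan_Suc binomial_Suc_Suc)
  \<comment> \<open>The 1 is the summand at k = n; it is also the 1 of
    \<open>binom_sum_0_split\<close>.\<close>
  also have "\<dots> = (\<Sum>k<n. (int (k choose (n - Suc k)) + int (k choose Suc (n - Suc k)))\<^sup>2) + 1"
  proof -
    have "(\<Sum>k<n. int (Suc k choose (n - k)) * int (Suc k choose (n - k)))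
      = (\<Sum>k<n. (int (k choose (n - Suc k)) + int (k choose Suc (n - Suc k)))\<^sup>2)"
      by (rule sum.cong) (auto simp: power2_eq_square Suc_diff_Suc[symmetric])
    then show ?thesis by simp
  qed
  also have "\<dots> = binom_sum 0 (n + 1) + binom_sum 0 n + 2 * binom_sum 1 n"
    unfolding binom_sum_0_split
    by (simp add: binom_sum_def power2_eq_square algebra_simps sum.distrib sum_distrib_left)
  finally show ?thesis .
qed

text \<open>Here Pascal's rule turns each summand into (p + q)(q + r), and the product p r brings in
  \<open>binom_sum 2\<close>. The boundary term n + 1 at k = n is shared between the two split
  lemmas.\<close>

lemma binom_sum_1_Pascal:
  "binom_sum 1 (n + 2) = binom_sum 1 (n + 1) + binom_sum 1 n + binom_sum 0 (n + 1) + binom_sum 2 n"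
proof -
  have "binom_sum 1 (n + 2) = (\<Sum>k<Suc n. int (Suc k choose (n - k)) * int (Suc k choose Suc (n - k)))"
    unfolding binom_sum_def
    by (simp add: sum.lessThan_Suc_shift del: sum.lessThan_Suc binomial_Suc_Suc)
  also have "\<dots> = (\<Sum>k<n. (int (k choose (n - Suc k)) + int (k choose Suc (n - Suc k))) *
      (int (k choose Suc (n - Suc k)) + int (k choose Suc (Suc (n - Suc k))))) + (int n + 1)"
  proof -
    have "(\<Sum>k<n. int (Suc k choose (n - k)) * int (Suc k choose Suc (n - k)))
      = (\<Sum>k<n. (int (k choose (n - Suc k)) + int (k choose Suc (n - Suc k))) *
      (int (k choose Suc (n - Suc k)) + int (k choose Suc (Suc (n - Suc k)))))"
      by (rule sum.cong) (auto simp: Suc_diff_Suc[symmetric])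
    then show ?thesis by simp
  qed
  also have "\<dots> = binom_sum 1 (n + 1) + binom_sum 1 n + binom_sum 0 (n + 1) + binom_sum 2 n"
    unfolding binom_sum_0_split binom_sum_1_split
    by (simp add: binom_sum_def power2_eq_square algebra_simps sum.distrib)
  finally show ?thesis .
qed

text \<open>This is \<open>binomial_three_term\<close> at j = n - 1 - k, summed over k. The boundary
  corrections of the two split lemmas, n times 1 and n, cancel.\<close>

lemma binom_sum_2_eq:
  "(int n + 3) * binom_sum 2 n =
     int n * binom_sum 0 (n + 1) - binom_sum 1 (n + 1) - 2 * binom_sum 1 n"
proof -
  let ?p = "\<lambda>k. int (k choose (n - Suc k))" and ?q = "\<lambda>k. int (k choose Suc (n - Suc k))"
    and ?r = "\<lambda>k. int (k choose Suc (Suc (n - Suc k)))"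
  have "(int n + 3) * (?p k * ?r k) = int n * (?q k)\<^sup>2 - ?q k * ?r k - 2 * (?p k * ?q k)"
    if "k < n" for k
    using binomial_three_term[of k "n - Suc k"] that by (simp add: of_nat_diff algebra_simps)
  then have "(\<Sum>k<n. (int n + 3) * (?p k * ?r k))
      = (\<Sum>k<n. int n * (?q k)\<^sup>2 - ?q k * ?r k - 2 * (?p k * ?q k))"
    by (intro sum.cong) auto
  then show ?thesis
    unfolding binom_sum_0_split binom_sum_1_split
    by (simp add: binom_sum_def sum_subtractf right_diff_distrib distrib_left flip: sum_distrib_left)
qed

lemma binom_sum_0_rec:
  "(int m + 3) * binom_sum 0 (m + 4) =
     (2 * int m + 5) * binom_sum 0 (m + 3) + (int m + 2) * binom_sum 0 (m + 2)
     + (2 * int m + 3) * binom_sum 0 (m + 1) - (int m + 1) * binom_sum 0 m"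
proof -
  \<comment> \<open>Eliminating \<open>binom_sum 2\<close> leaves D and a single W; the instances of
    \<open>binom_sum_0_Pascal\<close> below then replace D by W.\<close>
  have "(int m + 3) * binom_sum 1 (m + 2) = (int m + 2) * binom_sum 1 (m + 1)
      + (int m + 1) * binom_sum 1 m + (2 * int m + 3) * binom_sum 0 (m + 1)"
    using binom_sum_1_Pascal[of m] binom_sum_2_eq[of m] by algebra
  moreover have "2 * binom_sum 1 (m + i) =
      binom_sum 0 (m + (i + 2)) - binom_sum 0 (m + (i + 1)) - binom_sum 0 (m + i)" for i
    using binom_sum_0_Pascal[of "m + i"] by (simp add: add.assoc)
  from this[of 0] this[of 1] this[of 2]
  have "2 * binom_sum 1 m = binom_sum 0 (m + 2) - binom_sum 0 (m + 1) - binom_sum 0 m"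
    "2 * binom_sum 1 (m + 1) = binom_sum 0 (m + 3) - binom_sum 0 (m + 2) - binom_sum 0 (m + 1)"
    "2 * binom_sum 1 (m + 2) = binom_sum 0 (m + 4) - binom_sum 0 (m + 3) - binom_sum 0 (m + 2)"
    by (simp_all add: numeral_eq_Suc)
  ultimately have "2 * ((int m + 3) * binom_sum 0 (m + 4)) =
     2 * ((2 * int m + 5) * binom_sum 0 (m + 3) + (int m + 2) * binom_sum 0 (m + 2)
     + (2 * int m + 3) * binom_sum 0 (m + 1) - (int m + 1) * binom_sum 0 m)"
    by algebra
  then show ?thesis by simp
qed

section \<open>Sign-weighted binomial convolutions\<close>

text \<open>The reflection of i into s - i preserves the product, because both coefficients have the
  same upper index k, and it negates the argument of the sign up to replacing c by -c.\<close>

lemma binomial_sgn_sum_uminus: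
  "(\<Sum>i\<le>s. int (k choose i) * int (k choose (s - i)) * sgn (2 * int i - int s - c)) =
     - (\<Sum>i\<le>s. int (k choose i) * int (k choose (s - i)) * sgn (2 * int i - int s + c))"
  unfolding sum_negf[symmetric]
  by (rule sum.reindex_bij_witness[of _ "\<lambda>i. s - i" "\<lambda>i. s - i"])
    (auto simp: of_nat_diff sgn_if)

lemma binomial_sgn_sum_0:
  "(\<Sum>i\<le>s. int (k choose i) * int (k choose (s - i)) * sgn (2 * int i - int s)) = 0"
  using binomial_sgn_sum_uminus[where c = 0] by simp

lemma binomial_sgn_sum_1:
  "(\<Sum>i\<le>s. int (k choose i) * int (k choose (s - i)) * sgn (2 * int i - int s + 1)) =
     int (k choose (s div 2)) * int (k choose (s - s div 2))"
    (is "?S = ?R")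
proof -
  let ?c = "\<lambda>i. int (k choose i) * int (k choose (s - i))"
  \<comment> \<open>The two signs differ only where 2i - s is -1, 0 or 1. For even s both indicators
    meet at the middle and add up to 2; for odd s they mark the two middle indices, where the
    products agree by symmetry.\<close>
  have sgn: "sgn (2 * int i - int s + 1) - sgn (2 * int i - int s - 1) =
      (if i = s div 2 then 1 else 0) + (if i = s - s div 2 then 1 else 0)" for i
  proof (cases "even s")
    case True
    then obtain t where s: "s = 2 * t" by (elim evenE)
    consider "i < t" | "i = t" | "i > t" by linarith
    then show ?thesis by cases (auto simp: s sgn_if)
  next
    case False
    then obtain t where s: "s = 2 * t + 1" by (elim oddE)
    consider "i < t" | "i = t" | "i = t + 1" | "i > t + 1" by linarith
    then show ?thesis by cases (auto simp: s sgn_if)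
  qed
  have "2 * ?S = ?S - (\<Sum>i\<le>s. ?c i * sgn (2 * int i - int s - 1))"
    using binomial_sgn_sum_uminus[where c = 1] by simp
  also have "\<dots> = (\<Sum>i\<le>s. ?c i * (sgn (2 * int i - int s + 1) - sgn (2 * int i - int s - 1)))"
    by (simp add: sum_subtractf right_diff_distrib)
  also have "\<dots> = (\<Sum>i\<le>s. ?c i * ((if i = s div 2 then 1 else 0) + (if i = s - s div 2 then 1 else 0)))"
    by (rule sum.cong) (auto simp: sgn)
  also have "\<dots> = (\<Sum>i\<le>s. if i = s div 2 then ?c i else 0)
      + (\<Sum>i\<le>s. if i = s - s div 2 then ?c i else 0)"
    unfolding sum.distrib[symmetric] by (rule sum.cong) auto
  also have "\<dots> = 2 * ?R"
    by (simp add: sum.delta)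
  finally show ?thesis by simp
qed

text \<open>Pascal's rule on \<open>Suc k choose i\<close> gives two sums with equal upper indices.
  The first is the reflection of \<open>binomial_sgn_sum_1\<close>; the second cancels.\<close>

lemma binomial_Suc_sgn_sum:
  "(\<Sum>i\<le>s. int (Suc k choose i) * int (k choose (s - i)) * sgn (2 * int i - int s - 1)) =
     - (int (k choose (s div 2)) * int (k choose (s - s div 2)))"
proof -
  let ?g = "\<lambda>i. int (k choose (s - i)) * sgn (2 * int i - int s - 1)"
  have "(\<Sum>i\<le>s. int (Suc k choose i) * ?g i) =
      (\<Sum>i\<le>s. int (k choose i) * ?g i) + (\<Sum>i<s. int (k choose i) * ?g (Suc i))"
  proof (cases s)
    case (Suc t)
    have "(\<Sum>i\<le>s. int (Suc k choose i) * ?g i) =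
        ?g 0 + (\<Sum>i\<le>t. (int (k choose i) + int (k choose Suc i)) * ?g (Suc i))"
      unfolding Suc by (subst sum.atMost_Suc_shift) simp
    also have "\<dots> = (?g 0 + (\<Sum>i\<le>t. int (k choose Suc i) * ?g (Suc i)))
        + (\<Sum>i\<le>t. int (k choose i) * ?g (Suc i))"
      by (simp add: distrib_right sum.distrib del: of_nat_Suc)
    also have "?g 0 + (\<Sum>i\<le>t. int (k choose Suc i) * ?g (Suc i)) = (\<Sum>i\<le>s. int (k choose i) * ?g i)"
      unfolding Suc by (subst sum.atMost_Suc_shift) simp
    finally show ?thesis by (simp only: Suc lessThan_Suc_atMost)
  qed simp
  \<comment> \<open>After the shift of i this is the symmetric sum \<open>binomial_sgn_sum_0\<close>
    for s - 1.\<close>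
  moreover have "(\<Sum>i<s. int (k choose i) * ?g (Suc i)) = 0"
  proof (cases s)
    case (Suc t)
    then show ?thesis
      using binomial_sgn_sum_0[of k t] by (simp add: lessThan_Suc_atMost algebra_simps)
  qed simp
  ultimately show ?thesis
    using binomial_sgn_sum_uminus[of k s 1] binomial_sgn_sum_1[of k s] by (simp add: mult.assoc)
qed

section \<open>Partitions as sets of odd and even parts\<close>

text \<open>A weighted Vandermonde convolution: S corresponds to the pair of its traces on A and B,
  and the summand depends only on their sizes.\<close>

lemma sum_subsets_of_Un:
  fixes g :: "nat \<Rightarrow> nat \<Rightarrow> 'b::comm_semiring_1"
  assumes "finite A" "finite B" "A \<inter> B = {}"
  shows "(\<Sum>S | S \<subseteq> A \<union> B \<and> card S = s. g (card (S \<inter> A)) (card (S \<inter> B))) =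
    (\<Sum>i\<le>s. of_nat (card A choose i) * of_nat (card B choose (s - i)) * g i (s - i))"
proof -
  let ?F = "\<lambda>i. {P. P \<subseteq> A \<and> card P = i} \<times> {Q. Q \<subseteq> B \<and> card Q = s - i}"
  have "(\<Sum>S | S \<subseteq> A \<union> B \<and> card S = s. g (card (S \<inter> A)) (card (S \<inter> B))) =
      (\<Sum>(i, P, Q)\<in>(SIGMA i:{..s}. ?F i). g i (s - i))"
  proof (rule sum.reindex_bij_witness[of _ "\<lambda>(i, P, Q). P \<union> Q"
        "\<lambda>S. (card (S \<inter> A), S \<inter> A, S \<inter> B)"])
    fix S assume "S \<in> {S. S \<subseteq> A \<union> B \<and> card S = s}"
    then have S: "S \<subseteq> A \<union> B" "card S = s" by auto
    then have "S = (S \<inter> A) \<union> (S \<inter> B)" by blast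
    then have "card S = card (S \<inter> A) + card (S \<inter> B)"
      using assms by (metis card_Un_disjoint finite_Int inf_assoc inf_bot_right inf_left_commute)
    then have c: "card (S \<inter> B) = s - card (S \<inter> A)" "card (S \<inter> A) \<le> s"
      using S by auto
    then show "(card (S \<inter> A), S \<inter> A, S \<inter> B) \<in> (SIGMA i:{..s}. ?F i)" by auto
    show "(case (card (S \<inter> A), S \<inter> A, S \<inter> B) of (i, P, Q) \<Rightarrow> g i (s - i)) =
        g (card (S \<inter> A)) (card (S \<inter> B))"
      using c by simp
    show "(case (card (S \<inter> A), S \<inter> A, S \<inter> B) of (i, P, Q) \<Rightarrow> P \<union> Q) = S"
      using S by auto
  next
    fix x assume "x \<in> (SIGMA i:{..s}. ?F i)"
    then obtain i P Q where x: "x = (i, P, Q)" "i \<le> s" "P \<subseteq> A" "card P = i" "Q \<subseteq> B"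
      "card Q = s - i" by auto
    moreover have "card (P \<union> Q) = card P + card Q"
      using x assms by (intro card_Un_disjoint) (auto dest: finite_subset)
    ultimately show "(case x of (i, P, Q) \<Rightarrow> P \<union> Q) \<in> {S. S \<subseteq> A \<union> B \<and> card S = s}" by auto
    have "(P \<union> Q) \<inter> A = P" "(P \<union> Q) \<inter> B = Q" using x assms by auto
    then show "(card ((case x of (i, P, Q) \<Rightarrow> P \<union> Q) \<inter> A), (case x of (i, P, Q) \<Rightarrow> P \<union> Q) \<inter> A,
        (case x of (i, P, Q) \<Rightarrow> P \<union> Q) \<inter> B) = x"
      using x by simp
  qed
  also have "\<dots> = (\<Sum>i\<le>s. \<Sum>(P, Q)\<in>?F i. g i (s - i))"
    using assms by (subst sum.Sigma) (auto simp: split_def)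
  also have "\<dots> = (\<Sum>i\<le>s. of_nat (card A choose i) * of_nat (card B choose (s - i)) * g i (s - i))"
    using assms by (simp add: split_def card_cartesian_product n_subsets)
  finally show ?thesis .
qed

lemma card_odd_below: "card {y \<in> {1..<x}. odd y} = x div 2"
proof (induction x)
  case (Suc x)
  have "{y \<in> {1..<Suc x}. odd y} =
      (if odd x then insert x {y \<in> {1..<x}. odd y} else {y \<in> {1..<x}. odd y})"
    by (auto simp: less_Suc_eq Suc_le_eq odd_pos)
  with Suc show ?case by simp
qed simp

lemma card_even_below: "card {y \<in> {1..<x}. even y} = (x - 1) div 2"
proof (induction x)
  case (Suc x)
  have "{y \<in> {1..<Suc x}. even y} =
      (if even x \<and> 0 < x then insert x {y \<in> {1..<x}. even y} else {y \<in> {1..<x}. even y})"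
    by (auto simp: less_Suc_eq Suc_le_eq)
  moreover have "x div 2 = (if even x \<and> 0 < x then Suc ((x - 1) div 2) else (x - 1) div 2)"
    by presburger
  ultimately show ?case using Suc by simp
qed simp

lemma rd_diff_eq_sum_sgn:
  "int (rd_o n) - int (rd_e n) =
     (\<Sum>\<mu>\<in>distinct_partitions n. sgn (int (odd_parts \<mu>) - int (even_parts \<mu>)))"
proof -
  have "(\<Sum>\<mu>\<in>distinct_partitions n. sgn (int (odd_parts \<mu>) - int (even_parts \<mu>))) =
      (\<Sum>\<mu>\<in>distinct_partitions n. (if odd_parts \<mu> > even_parts \<mu> then 1 else 0)
        - (if even_parts \<mu> > odd_parts \<mu> then 1 else 0))"
    by (rule sum.cong) (auto simp: sgn_if)
  then show ?thesis
    by (simp add: sum_subtractf rd_o_def rd_e_def finite_distinct_partitions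
        flip: sum.inter_filter)
qed

text \<open>A strictly decreasing list is determined by its head x and the set S of its other
  entries. As the head counts once in the length, perimeter n means that S has n - x
  elements.\<close>

lemma sum_distinct_partitions:
  fixes f :: "nat \<Rightarrow> nat \<Rightarrow> 'b::comm_monoid_add"
  shows "(\<Sum>\<mu>\<in>distinct_partitions n. f (odd_parts \<mu>) (even_parts \<mu>)) =
    (\<Sum>x=1..n. \<Sum>S | S \<subseteq> {1..<x} \<and> card S = n - x.
      f (card {y \<in> insert x S. odd y}) (card {y \<in> insert x S. even y}))"
proof -
  have strict: "is_partition \<mu> \<and> distinct \<mu> \<longleftrightarrow> sorted_wrt (>) \<mu> \<and> 0 \<notin> set \<mu>" for \<mu>
    using sorted_wrt_rev[of "(<)" \<mu>] sorted_wrt_rev[of "(\<le>)" \<mu>]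
    by (auto simp: is_partition_def strict_sorted_iff intro!: gr0I)
  have parts: "odd_parts \<mu> = card {y \<in> set \<mu>. odd y}" "even_parts \<mu> = card {y \<in> set \<mu>. even y}"
    if "distinct \<mu>" for \<mu>
    using distinct_card[of "filter odd \<mu>"] distinct_card[of "filter even \<mu>"] that
    by (simp_all add: odd_parts_def even_parts_def)
  have rev: "sorted_wrt (>) \<mu> \<longleftrightarrow> sorted_wrt (<) (rev \<mu>)" for \<mu> :: "nat list"
    by (simp add: sorted_wrt_rev)
  have "(\<Sum>\<mu>\<in>distinct_partitions n. f (odd_parts \<mu>) (even_parts \<mu>)) =
      (\<Sum>(x, S)\<in>(SIGMA x:{1..n}. {S. S \<subseteq> {1..<x} \<and> card S = n - x}).
        f (card {y \<in> insert x S. odd y}) (card {y \<in> insert x S. even y}))"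
  proof (rule sum.reindex_bij_witness[of _ "\<lambda>(x, S). x # rev (sorted_list_of_set S)"
        "\<lambda>\<mu>. (hd \<mu>, set (tl \<mu>))"])
    fix \<mu> assume "\<mu> \<in> distinct_partitions n"
    then obtain x \<nu> where \<mu>: "\<mu> = x # \<nu>" "sorted_wrt (>) (x # \<nu>)" "0 \<notin> set (x # \<nu>)"
      "distinct (x # \<nu>)" "n = x + length \<nu>"
      using strict[of \<mu>] by (cases \<mu>) (simp_all add: distinct_partitions_def perimeter_def)
    then have "sorted_list_of_set (set \<nu>) = rev \<nu>"
      using rev[of \<nu>] sorted_list_of_set.idem_if_sorted_distinct[of "rev \<nu>"]
      by (simp add: strict_sorted_iff)
    then show "(case (hd \<mu>, set (tl \<mu>)) of (x, S) \<Rightarrow> x # rev (sorted_list_of_set S)) = \<mu>"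
      using \<mu> by simp
    have "0 \<notin> set \<nu>" "\<forall>y\<in>set \<nu>. y < x" "0 < x" "distinct \<nu>"
      using \<mu>(2-4) by auto
    then have "set \<nu> \<subseteq> {1..<x}" "card (set \<nu>) = length \<nu>" "1 \<le> x"
      by (auto simp: distinct_card Suc_le_eq intro!: gr0I)
    then show "(hd \<mu>, set (tl \<mu>)) \<in> (SIGMA x:{1..n}. {S. S \<subseteq> {1..<x} \<and> card S = n - x})"
      using \<mu>(1,5) by simp
    show "(case (hd \<mu>, set (tl \<mu>)) of (x, S) \<Rightarrow>
        f (card {y \<in> insert x S. odd y}) (card {y \<in> insert x S. even y})) =
        f (odd_parts \<mu>) (even_parts \<mu>)"
      using \<mu>(1) parts[of \<mu>] \<mu>(4) by simp
  next
    fix z assume "z \<in> (SIGMA x:{1..n}. {S. S \<subseteq> {1..<x} \<and> card S = n - x})"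
    then obtain x S where z: "z = (x, S)" "1 \<le> x" "x \<le> n" "S \<subseteq> {1..<x}" "card S = n - x"
      by auto
    then have "finite S" by (auto dest: finite_subset)
    moreover have "sorted_wrt (>) (rev (sorted_list_of_set S))"
      using rev[of "rev (sorted_list_of_set S)"] by simp
    ultimately show "(case z of (x, S) \<Rightarrow> x # rev (sorted_list_of_set S)) \<in> distinct_partitions n"
      using z strict[of "x # rev (sorted_list_of_set S)"]
      by (auto simp: distinct_partitions_def perimeter_def)
    show "(hd (case z of (x, S) \<Rightarrow> x # rev (sorted_list_of_set S)),
        set (tl (case z of (x, S) \<Rightarrow> x # rev (sorted_list_of_set S)))) = z"
      using z \<open>finite S\<close> by simp
  qed
  also have "\<dots> = (\<Sum>x=1..n. \<Sum>S | S \<subseteq> {1..<x} \<and> card S = n - x.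
      f (card {y \<in> insert x S. odd y}) (card {y \<in> insert x S. even y}))"
    by (rule sum.Sigma[symmetric]) auto
  finally show ?thesis .
qed

lemma sum_sgn_largest_part:
  assumes "1 \<le> x"
  shows "(\<Sum>S | S \<subseteq> {1..<x} \<and> card S = s.
      sgn (int (card {y \<in> insert x S. odd y}) - int (card {y \<in> insert x S. even y}))) =
    (if odd x then 1 else - 1) *
      (int ((x - 1) div 2 choose (s div 2)) * int ((x - 1) div 2 choose (s - s div 2)))"
proof -
  let ?O = "{y \<in> {1..<x}. odd y}" and ?E = "{y \<in> {1..<x}. even y}"
  \<comment> \<open>The contribution of the largest part x itself to the excess of odd
    parts.\<close>
  define c :: int where "c = (if odd x then 1 else - 1)"
  have un: "?O \<union> ?E = {1..<x}" by auto
  have "int (card {y \<in> insert x S. odd y}) - int (card {y \<in> insert x S. even y}) =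
      int (card (S \<inter> ?O)) - int (card (S \<inter> ?E)) + c" if "S \<subseteq> {1..<x}" for S
  proof -
    have S: "finite S" "x \<notin> S" using that by (auto dest: finite_subset)
    have "S \<inter> ?O = {y \<in> S. odd y}" "S \<inter> ?E = {y \<in> S. even y}" using that by auto
    moreover have "{y \<in> insert x S. odd y} = (if odd x then insert x {y \<in> S. odd y} else {y \<in> S. odd y})"
      "{y \<in> insert x S. even y} = (if odd x then {y \<in> S. even y} else insert x {y \<in> S. even y})"
      by auto
    ultimately show ?thesis using S by (simp add: c_def)
  qed
  then have "(\<Sum>S | S \<subseteq> {1..<x} \<and> card S = s.
      sgn (int (card {y \<in> insert x S. odd y}) - int (card {y \<in> insert x S. even y}))) =
      (\<Sum>S | S \<subseteq> ?O \<union> ?E \<and> card S = s. sgn (int (card (S \<inter> ?O)) - int (card (S \<inter> ?E)) + c))"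
    unfolding un by (intro sum.cong) auto
  also have "\<dots> = (\<Sum>i\<le>s. int (card ?O choose i) * int (card ?E choose (s - i)) *
      sgn (int i - int (s - i) + c))"
    by (rule sum_subsets_of_Un) auto
  also have "\<dots> = (\<Sum>i\<le>s. int (x div 2 choose i) * int ((x - 1) div 2 choose (s - i)) *
      sgn (2 * int i - int s + c))"
    unfolding card_odd_below card_even_below
    by (rule sum.cong) (auto simp: of_nat_diff algebra_simps)
  \<comment> \<open>For odd x there are equally many odd and even numbers below x; for even x there
    is one more odd number, which calls for \<open>binomial_Suc_sgn_sum\<close>.\<close>
  also have "\<dots> = c * (int ((x - 1) div 2 choose (s div 2)) * int ((x - 1) div 2 choose (s - s div 2)))"
  proof (cases "odd x")
    case True
    then have "x div 2 = (x - 1) div 2" by (auto elim: oddE)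
    then show ?thesis using True binomial_sgn_sum_1 by (simp add: c_def)
  next
    case False
    then have "x div 2 = Suc ((x - 1) div 2)" using assms by (auto elim!: evenE)
    then show ?thesis
      using False binomial_Suc_sgn_sum[of "(x - 1) div 2" s] by (simp add: c_def del: binomial_Suc_Suc)
  qed
  finally show ?thesis by (simp add: c_def)
qed

section \<open>Closed forms for the two sequences\<close>

lemma rd_diff_eq:
  "int (rd_o n) - int (rd_e n) = (\<Sum>x=1..n. (if odd x then 1 else - 1) *
     (int ((x - 1) div 2 choose ((n - x) div 2)) *
      int ((x - 1) div 2 choose (n - x - (n - x) div 2))))"
  unfolding rd_diff_eq_sum_sgn
    sum_distinct_partitions[of "\<lambda>i j. sgn (int i - int j)"]
  by (intro sum.cong refl sum_sgn_largest_part) simp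

text \<open>The pairing of 2k + 1 with 2k + 2 is chosen because \<open>(x - 1) div 2\<close> equals
  k for both.\<close>

lemma sum_split_parity:
  fixes f :: "nat \<Rightarrow> 'a::comm_monoid_add"
  shows "(\<Sum>x=1..2 * m. f x) = (\<Sum>k<m. f (2 * k + 1)) + (\<Sum>k<m. f (2 * k + 2))"
  by (induction m) (simp_all add: ac_simps)

text \<open>With t = m - 1 - k, an odd x leaves 2t + 1 further parts, whose halves t and t + 1 give
  a term of D; an even x leaves 2t and gives a term of W with a minus sign.\<close>

lemma b_seq_eq: "b_seq m = binom_sum 1 m - binom_sum 0 m"
proof -
  have "b_seq m = (\<Sum>k<m. int (k choose (m - Suc k)) * int (k choose (m - Suc k + 1)))
      + (\<Sum>k<m. - (int (k choose (m - Suc k)) * int (k choose (m - Suc k + 0))))"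
    unfolding b_seq_def rd_diff_eq sum_split_parity
  proof (intro arg_cong2[of _ _ _ _ "(+)"] sum.cong refl)
    fix k assume "k \<in> {..<m}"
    then obtain t where m: "m = k + t + 1" by (auto simp: less_iff_Suc_add)
    have s: "2 * m - (2 * k + 1) = 2 * t + 1" "2 * m - (2 * k + 2) = 2 * t"
      by (simp_all add: m)
    show "(if odd (2 * k + 1) then 1 else - 1) *
       (int ((2 * k + 1 - 1) div 2 choose ((2 * m - (2 * k + 1)) div 2)) *
        int ((2 * k + 1 - 1) div 2 choose (2 * m - (2 * k + 1) - (2 * m - (2 * k + 1)) div 2))) =
       int (k choose (m - Suc k)) * int (k choose (m - Suc k + 1))"
      unfolding s by (simp add: m)
    show "(if odd (2 * k + 2) then 1 else - 1) *
       (int ((2 * k + 2 - 1) div 2 choose ((2 * m - (2 * k + 2)) div 2)) *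
        int ((2 * k + 2 - 1) div 2 choose (2 * m - (2 * k + 2) - (2 * m - (2 * k + 2)) div 2))) =
       - (int (k choose (m - Suc k)) * int (k choose (m - Suc k + 0)))"
      unfolding s by (simp add: m)
  qed
  then show ?thesis by (simp add: binom_sum_def sum_negf)
qed

lemma a_seq_eq: "a_seq m = binom_sum 0 (m + 1) - binom_sum 1 m"
proof -
  let ?f = "\<lambda>x. (if odd x then 1 else - 1) *
     (int ((x - 1) div 2 choose ((2 * m + 1 - x) div 2)) *
      int ((x - 1) div 2 choose (2 * m + 1 - x - (2 * m + 1 - x) div 2)))"
  \<comment> \<open>The odd largest part 2m + 1 has no even partner. It extends the sum over odd x
    to k = m, hence \<open>binom_sum 0 (m + 1)\<close>.\<close>
  have "a_seq m = (\<Sum>x=1..2 * m. ?f x) + ?f (2 * m + 1)"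
    unfolding a_seq_def rd_diff_eq by simp
  also have "\<dots> = (\<Sum>k<m + 1. ?f (2 * k + 1)) + (\<Sum>k<m. ?f (2 * k + 2))"
    unfolding sum_split_parity by simp
  also have "\<dots> = (\<Sum>k<m + 1. int (k choose (m + 1 - Suc k)) * int (k choose (m + 1 - Suc k + 0)))
      + (\<Sum>k<m. - (int (k choose (m - Suc k)) * int (k choose (m - Suc k + 1))))"
  proof (intro arg_cong2[of _ _ _ _ "(+)"] sum.cong refl)
    fix k assume "k \<in> {..<m + 1}"
    then obtain t where m: "m = k + t" by (auto simp: less_Suc_eq_le le_iff_add)
    have s: "2 * m + 1 - (2 * k + 1) = 2 * t" by (simp add: m)
    show "?f (2 * k + 1) = int (k choose (m + 1 - Suc k)) * int (k choose (m + 1 - Suc k + 0))"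
      unfolding s by (simp add: m)
  next
    fix k assume "k \<in> {..<m}"
    then obtain t where m: "m = k + t + 1" by (auto simp: less_iff_Suc_add)
    have s: "2 * m + 1 - (2 * k + 2) = 2 * t + 1" by (simp add: m)
    show "?f (2 * k + 2) = - (int (k choose (m - Suc k)) * int (k choose (m - Suc k + 1)))"
      unfolding s by (simp add: m)
  qed
  finally show ?thesis by (simp add: binom_sum_def sum_negf del: sum.lessThan_Suc)
qed

section \<open>Elimination\<close>

theorem lemma4p3:
  shows "(\<forall>m::nat.
      (int m + 5) * (4 * int m ^ 2 + 28 * int m + 29) * a_seq (m + 4) =
        4 * (2 * int m ^ 3 + 21 * int m ^ 2 + 58 * int m + 43) * a_seq (m + 1)
      + (4 * int m ^ 3 + 44 * int m ^ 2 + 127 * int m + 117) * a_seq (m + 2)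
      + 2 * (4 * int m ^ 3 + 46 * int m ^ 2 + 142 * int m + 107) * a_seq (m + 3)
      - (int m + 1) * (4 * int m ^ 2 + 36 * int m + 61) * a_seq m)
    \<and> (\<forall>m::nat.
      (int m + 5) * (int m ^ 2 + 2 * int m - 2) * b_seq (m + 4) =
        int m * (int m + 4) * (2 * int m + 3) * b_seq (m + 1)
      + (int m + 1) * (int m ^ 2 + 5 * int m + 8) * b_seq (m + 2)
      + (int m + 1) * (int m + 4) * (2 * int m + 3) * b_seq (m + 3)
      - (int m + 1) * (int m ^ 2 + 4 * int m + 1) * b_seq m)"
proof (intro conjI allI)
  fix m :: nat
  define w where "w i = binom_sum 0 (m + i)" for i
  \<comment> \<open>The defect of \<open>binom_sum_0_rec\<close> at m + i. Keeping it as an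
    expression reduces each claim to a polynomial identity in m and the \<open>w i\<close>. Doubling
    the sequences avoids halves.\<close>
  define r where "r i = (int m + int i + 3) * w (i + 4) - (2 * (int m + int i) + 5) * w (i + 3)
      - (int m + int i + 2) * w (i + 2) - (2 * (int m + int i) + 3) * w (i + 1)
      + (int m + int i + 1) * w i" for i
  have a: "2 * a_seq (m + i) = 3 * w (i + 1) - w (i + 2) + w i"
    and b: "2 * b_seq (m + i) = w (i + 2) - w (i + 1) - 3 * w i" for i
    using binom_sum_0_Pascal[of "m + i"] by (simp_all add: a_seq_eq b_seq_eq w_def add.assoc)
  have r_eq_0: "r i = 0" for i
    using binom_sum_0_rec[of "m + i"] by (simp add: r_def w_def add.assoc)
  note eval = arith_simps one_add_one one_plus_numeral numeral_plus_one of_nat_0 of_nat_1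
    of_nat_numeral
  note r = r_def[of 0, simplified eval] r_def[of 1, simplified eval] r_def[of 2, simplified eval]
  note a = a[of 0, simplified eval] a[of 1, simplified eval] a[of 2, simplified eval]
    a[of 3, simplified eval] a[of 4, simplified eval]
  note b = b[of 0, simplified eval] b[of 1, simplified eval] b[of 2, simplified eval]
    b[of 3, simplified eval] b[of 4, simplified eval]
  show "(int m + 5) * (4 * int m ^ 2 + 28 * int m + 29) * a_seq (m + 4) =
        4 * (2 * int m ^ 3 + 21 * int m ^ 2 + 58 * int m + 43) * a_seq (m + 1)
      + (4 * int m ^ 3 + 44 * int m ^ 2 + 127 * int m + 117) * a_seq (m + 2)
      + 2 * (4 * int m ^ 3 + 46 * int m ^ 2 + 142 * int m + 107) * a_seq (m + 3)
      - (int m + 1) * (4 * int m ^ 2 + 36 * int m + 61) * a_seq m"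
    (is "?l = ?r")
  proof -
    \<comment> \<open>The coefficients of \<open>r 2\<close>, \<open>r 1\<close>, \<open>r 0\<close> come from eliminating \<open>w 6\<close>, \<open>w 5\<close>, \<open>w 4\<close> in turn.\<close>
    have "2 * ?l - 2 * ?r =
        (int m + 5) * (4 * int m ^ 2 + 28 * int m + 29) * (2 * a_seq (m + 4))
        - 4 * (2 * int m ^ 3 + 21 * int m ^ 2 + 58 * int m + 43) * (2 * a_seq (m + 1))
        - (4 * int m ^ 3 + 44 * int m ^ 2 + 127 * int m + 117) * (2 * a_seq (m + 2))
        - 2 * (4 * int m ^ 3 + 46 * int m ^ 2 + 142 * int m + 107) * (2 * a_seq (m + 3))
        + (int m + 1) * (4 * int m ^ 2 + 36 * int m + 61) * (2 * a_seq m)"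
      by (simp add: algebra_simps)
    also have "\<dots> = - (4 * int m ^ 2 + 28 * int m + 29) * r 2
        + (12 * int m ^ 2 + 96 * int m + 97) * r 1
        + (4 * int m ^ 2 + 36 * int m + 61) * r 0"
      unfolding a r by (simp add: algebra_simps power2_eq_square power3_eq_cube)
    finally show ?thesis by (simp add: r_eq_0)
  qed
  show "(int m + 5) * (int m ^ 2 + 2 * int m - 2) * b_seq (m + 4) =
        int m * (int m + 4) * (2 * int m + 3) * b_seq (m + 1)
      + (int m + 1) * (int m ^ 2 + 5 * int m + 8) * b_seq (m + 2)
      + (int m + 1) * (int m + 4) * (2 * int m + 3) * b_seq (m + 3)
      - (int m + 1) * (int m ^ 2 + 4 * int m + 1) * b_seq m"
    (is "?l = ?r")
  proof -
    have "2 * ?l - 2 * ?r =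
        (int m + 5) * (int m ^ 2 + 2 * int m - 2) * (2 * b_seq (m + 4))
        - int m * (int m + 4) * (2 * int m + 3) * (2 * b_seq (m + 1))
        - (int m + 1) * (int m ^ 2 + 5 * int m + 8) * (2 * b_seq (m + 2))
        - (int m + 1) * (int m + 4) * (2 * int m + 3) * (2 * b_seq (m + 3))
        + (int m + 1) * (int m ^ 2 + 4 * int m + 1) * (2 * b_seq m)"
      by (simp add: algebra_simps)
    \<comment> \<open>The same elimination of \<open>w 6\<close>, \<open>w 5\<close>,
      \<open>w 4\<close> yields these coefficients; the terms in \<open>w 0\<close> to
      \<open>w 3\<close> then agree as well.\<close>
    also have "\<dots> = (int m ^ 2 + 2 * int m - 2) * r 2
        - (int m ^ 2 + 3 * int m + 5) * r 1
        - (3 * int m ^ 2 + 12 * int m + 3) * r 0"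
      unfolding b r by (simp add: algebra_simps power2_eq_square power3_eq_cube)
    finally show ?thesis by (simp add: r_eq_0)
  qed
qed

end
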